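(* Every unit disc graph with maximum clique size $k$ has layered pathwidth at most $4k$.
   Context: For a finite set $P$ of points in the plane, the unit disc graph of $P$ is the graph with vertex set $P$, where two distinct points $v,w\in P$ are adjacent if and only if $\operatorname{dist}(v,w)\leq 1$ (Euclidean distance). A path decomposition of a graph is a sequence of vertex subsets (bags) such that each vertex belongs to a nonempty contiguous subsequence of bags and every two adjacent vertices have at least one bag in common. A layering of a graph is a partition of its vertices into a sequence of disjoint subsets (layers) such that each edge joins vertices in the same layer or in consecutive layers. The layered pathwidth of a graph $G$ is the minimum integer $k$ such that for some path decomposition and some layering of $G$, the intersection of each bag with each layer has at most $k$ vertices. *)

theory Defs
  imports "HOL-Analysis.Analysis"
begin

type_synonym 'a graph = "'a set \<times> 'a set set"

abbreviation verts :: "'a graph \<Rightarrow> 'a set" where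
  "verts G \<equiv> fst G"

abbreviation edges :: "'a graph \<Rightarrow> 'a set set" where
  "edges G \<equiv> snd G"

definition unit_disc_graph :: "(real ^ 2) set \<Rightarrow> (real ^ 2) graph" where
  "unit_disc_graph P = (P, {{v, w} | v w. v \<in> P \<and> w \<in> P \<and> v \<noteq> w \<and> dist v w \<le> 1})"

definition clique :: "'a graph \<Rightarrow> 'a set \<Rightarrow> bool" where
  "clique G C \<longleftrightarrow> C \<subseteq> verts G \<and> (\<forall>v\<in>C. \<forall>w\<in>C. v \<noteq> w \<longrightarrow> {v, w} \<in> edges G)"

text \<open>Meaningful for finite graphs. The empty set is a clique, so the graph without vertices
  has clique number 0.\<close>

definition clique_number :: "'a graph \<Rightarrow> nat" where
  "clique_number G = Max (card ` {C. clique G C})"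

definition path_decomposition :: "'a graph \<Rightarrow> 'a set list \<Rightarrow> bool" where
  "path_decomposition G Bs \<longleftrightarrow>
     (\<forall>B\<in>set Bs. B \<subseteq> verts G) \<and>
     (\<forall>v\<in>verts G. \<exists>i j. i \<le> j \<and> j < length Bs \<and>
        (\<forall>l<length Bs. v \<in> Bs ! l \<longleftrightarrow> i \<le> l \<and> l \<le> j)) \<and>
     (\<forall>e\<in>edges G. \<exists>B\<in>set Bs. e \<subseteq> B)"

text \<open>Layers may be empty. This does not affect the layered pathwidth: deleting the empty layers
  of a layering leaves a layering.\<close>

definition layering :: "'a graph \<Rightarrow> 'a set list \<Rightarrow> bool" where
  "layering G Ls \<longleftrightarrow>
     \<Union>(set Ls) = verts G \<and>
     (\<forall>i<length Ls. \<forall>j<length Ls. i \<noteq> j \<longrightarrow> Ls ! i \<inter> Ls ! j = {}) \<and>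
     (\<forall>e\<in>edges G. \<exists>i<length Ls.
        e \<subseteq> Ls ! i \<or> (Suc i < length Ls \<and> e \<subseteq> Ls ! i \<union> Ls ! Suc i))"

text \<open>Like the clique number, meaningful for finite graphs, where \<open>card\<close> is the actual cardinality.\<close>

definition layered_pathwidth :: "'a graph \<Rightarrow> nat" where
  "layered_pathwidth G =
     (LEAST k. \<exists>Bs Ls. path_decomposition G Bs \<and> layering G Ls \<and>
        (\<forall>B\<in>set Bs. \<forall>L\<in>set Ls. card (B \<inter> L) \<le> k))"

text \<open>The minimum is attained: one bag and one layer, each containing all vertices, satisfy the
  conditions with \<open>k\<close> the number of vertices.\<close>

lemma layered_pathwidth_attained:
  fixes G :: "'a graph"
  assumes "\<And>e. e \<in> edges G \<Longrightarrow> e \<subseteq> verts G"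
  shows "\<exists>Bs Ls. path_decomposition G Bs \<and> layering G Ls \<and>
           (\<forall>B\<in>set Bs. \<forall>L\<in>set Ls. card (B \<inter> L) \<le> layered_pathwidth G)"
proof -
  have "path_decomposition G [verts G]" "layering G [verts G]"
    using assms by (auto simp: path_decomposition_def layering_def)
  then have "\<exists>Bs Ls. path_decomposition G Bs \<and> layering G Ls \<and>
      (\<forall>B\<in>set Bs. \<forall>L\<in>set Ls. card (B \<inter> L) \<le> card (verts G))"
    by (intro exI[of _ "[verts G]"]) simp
  then show ?thesis
    unfolding layered_pathwidth_def by (rule LeastI)
qed

end

theory Submission
  imports Defs
begin

text \<open>A vertical slab of width 1 and a horizontal strip of height 1 meet in a unit square. Its
  four quarters are squares of side 1/2, whose diameter is less than 1, so the points in each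
  quarter form a clique and the unit square contains at most \<open>4 * k\<close> points.

  It remains to choose strips as layers and slabs as bags. Adjacent points differ by at most 1 in
  each coordinate. Hence the strips between consecutive integer heights form a layering
  (\<open>layering_floor\<close>). Sliding the slab from left to right, and stopping whenever its left side
  meets a point, gives a path decomposition (\<open>path_decomposition_sliding_window\<close>): a point stays
  in the slab for one interval of time, and the ends of an edge are both in the slab when its
  left side meets the left one of them. Both facts need just a real-valued function on the
  vertices that varies by at most 1 along every edge.\<close>

lemma sorted_indices_between:
  fixes xs :: "'a::linorder list"
  assumes "sorted xs" and "c \<in> set xs" and "a \<le> c" and "c \<le> b"
  shows "\<exists>i j. i \<le> j \<and> j < length xs \<and>
    (\<forall>l<length xs. a \<le> xs ! l \<and> xs ! l \<le> b \<longleftrightarrow> i \<le> l \<and> l \<le> j)"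
proof -
  define I where "I = {l. l < length xs \<and> a \<le> xs ! l \<and> xs ! l \<le> b}"
  have fin: "finite I"
    unfolding I_def by simp
  obtain l0 where "l0 < length xs" and "xs ! l0 = c"
    using \<open>c \<in> set xs\<close> by (auto simp: in_set_conv_nth)
  then have "l0 \<in> I"
    using assms by (simp add: I_def)
  then have ne: "I \<noteq> {}"
    by blast
  have min: "Min I \<in> I" and max: "Max I \<in> I"
    using fin ne by simp_all
  have "l \<in> I \<longleftrightarrow> Min I \<le> l \<and> l \<le> Max I" if "l < length xs" for l
  proof
    assume "l \<in> I"
    then show "Min I \<le> l \<and> l \<le> Max I"
      using fin by simp
  next
    assume l: "Min I \<le> l \<and> l \<le> Max I"
    have "xs ! Min I \<le> xs ! l"
      using \<open>sorted xs\<close> l that by (simp add: sorted_nth_mono)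
    moreover have "xs ! l \<le> xs ! Max I"
      using \<open>sorted xs\<close> l max by (simp add: sorted_nth_mono I_def)
    ultimately show "l \<in> I"
      using min max that by (auto simp: I_def)
  qed
  then have "\<forall>l<length xs. a \<le> xs ! l \<and> xs ! l \<le> b \<longleftrightarrow> Min I \<le> l \<and> l \<le> Max I"
    unfolding I_def by blast
  moreover have "Min I \<le> Max I"
    using fin min by simp
  moreover have "Max I < length xs"
    using max unfolding I_def by blast
  ultimately show ?thesis
    by blast
qed

text \<open>A vertex \<open>v\<close> lies in the window \<open>[t, t + 1]\<close> just when \<open>t\<close> is between \<open>x v - 1\<close> and
  \<open>x v\<close>, which holds for consecutive values \<open>t\<close> in the sorted list, among them \<open>x v\<close> itself.\<close>

lemma path_decomposition_sliding_window:
  fixes x :: "'a \<Rightarrow> real"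
  assumes "finite (verts G)"
    and edge: "\<And>e. e \<in> edges G \<Longrightarrow>
      \<exists>v w. e = {v, w} \<and> v \<in> verts G \<and> w \<in> verts G \<and> \<bar>x v - x w\<bar> \<le> 1"
  shows "path_decomposition G
    (map (\<lambda>t. {v \<in> verts G. t \<le> x v \<and> x v \<le> t + 1}) (sorted_list_of_set (x ` verts G)))"
    (is "path_decomposition G (map ?B ?ts)")
  unfolding path_decomposition_def
proof (intro conjI ballI)
  have set_ts: "set ?ts = x ` verts G"
    using assms(1) by simp
  show "B \<subseteq> verts G" if "B \<in> set (map ?B ?ts)" for B
    using that by auto
  show "\<exists>i j. i \<le> j \<and> j < length (map ?B ?ts) \<and>
      (\<forall>l<length (map ?B ?ts). v \<in> map ?B ?ts ! l \<longleftrightarrow> i \<le> l \<and> l \<le> j)"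
    if v: "v \<in> verts G" for v
  proof -
    have "\<exists>i j. i \<le> j \<and> j < length ?ts \<and>
        (\<forall>l<length ?ts. x v - 1 \<le> ?ts ! l \<and> ?ts ! l \<le> x v \<longleftrightarrow> i \<le> l \<and> l \<le> j)"
      using v set_ts by (intro sorted_indices_between[where c = "x v"]) auto
    moreover have "v \<in> ?B t \<longleftrightarrow> x v - 1 \<le> t \<and> t \<le> x v" for t
      using v by auto
    ultimately show ?thesis
      by simp
  qed
  show "\<exists>B\<in>set (map ?B ?ts). e \<subseteq> B" if e: "e \<in> edges G" for e
  proof -
    obtain v w where vw: "e = {v, w}" "v \<in> verts G" "w \<in> verts G" "\<bar>x v - x w\<bar> \<le> 1"
      using edge[OF e] by blast
    then have "e \<subseteq> ?B (min (x v) (x w))"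
      by auto
    moreover have "min (x v) (x w) \<in> set ?ts"
      unfolding set_ts using vw by (simp add: min_def)
    ultimately show ?thesis
      by auto
  qed
qed

text \<open>If two numbers differ by at most 1, then so do their floors.\<close>

lemma layering_floor:
  fixes y :: "'a \<Rightarrow> real"
  assumes fin: "finite (verts G)"
    and edge: "\<And>e. e \<in> edges G \<Longrightarrow>
      \<exists>v w. e = {v, w} \<and> v \<in> verts G \<and> w \<in> verts G \<and> \<bar>y v - y w\<bar> \<le> 1"
  obtains Ls where "layering G Ls"
    and "\<And>L. L \<in> set Ls \<Longrightarrow> \<exists>h. L = {v \<in> verts G. \<lfloor>y v\<rfloor> = h}"
proof -
  \<comment> \<open>A list is indexed from 0, so heights are shifted by a lower bound \<open>- M\<close> of theirs.\<close>
  define M where "M = (\<Sum>v\<in>verts G. \<bar>\<lfloor>y v\<rfloor>\<bar>)"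
  have M: "\<bar>\<lfloor>y v\<rfloor>\<bar> \<le> M" if "v \<in> verts G" for v
    unfolding M_def
    using member_le_sum[of v "verts G" "\<lambda>v. \<bar>\<lfloor>y v\<rfloor>\<bar>"] fin that by simp
  define N where "N = nat (2 * M + 1)"
  define L where "L i = {v \<in> verts G. \<lfloor>y v\<rfloor> = int i - M}" for i
  have height: "nat (\<lfloor>y v\<rfloor> + M) < N" "int (nat (\<lfloor>y v\<rfloor> + M)) = \<lfloor>y v\<rfloor> + M"
    if "v \<in> verts G" for v
    using M[OF that] by (simp_all add: N_def)
  have "layering G (map L [0..<N])"
    unfolding layering_def
  proof (intro conjI ballI)
    show "\<Union> (set (map L [0..<N])) = verts G"
    proof
      show "verts G \<subseteq> \<Union> (set (map L [0..<N]))"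
      proof
        fix v assume v: "v \<in> verts G"
        then have "v \<in> L (nat (\<lfloor>y v\<rfloor> + M))"
          using height(2)[OF v] by (simp add: L_def)
        then show "v \<in> \<Union> (set (map L [0..<N]))"
          using height(1)[OF v] by auto
      qed
    qed (auto simp: L_def)
    show "\<forall>i<length (map L [0..<N]). \<forall>j<length (map L [0..<N]).
        i \<noteq> j \<longrightarrow> map L [0..<N] ! i \<inter> map L [0..<N] ! j = {}"
      by (auto simp: L_def)
    show "\<exists>i<length (map L [0..<N]). e \<subseteq> map L [0..<N] ! i \<or>
        (Suc i < length (map L [0..<N]) \<and> e \<subseteq> map L [0..<N] ! i \<union> map L [0..<N] ! Suc i)"
      if e: "e \<in> edges G" for e
    proof -
      obtain v w where vw: "e = {v, w}" "v \<in> verts G" "w \<in> verts G" "\<bar>y v - y w\<bar> \<le> 1"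
          and le: "\<lfloor>y v\<rfloor> \<le> \<lfloor>y w\<rfloor>"
      proof -
        obtain v w where "e = {v, w}" "v \<in> verts G" "w \<in> verts G" "\<bar>y v - y w\<bar> \<le> 1"
          using edge[OF e] by blast
        then show thesis
          using that[of v w] that[of w v]
          by (cases "\<lfloor>y v\<rfloor> \<le> \<lfloor>y w\<rfloor>") (auto simp: abs_minus_commute insert_commute)
      qed
      define i where "i = nat (\<lfloor>y v\<rfloor> + M)"
      have i: "i < N" "int i = \<lfloor>y v\<rfloor> + M"
        using height vw(2) by (simp_all add: i_def)
      have "\<lfloor>y w\<rfloor> \<le> \<lfloor>y v\<rfloor> + 1"
        using vw(4) by linarith
      then consider "\<lfloor>y w\<rfloor> = \<lfloor>y v\<rfloor>" | "\<lfloor>y w\<rfloor> = \<lfloor>y v\<rfloor> + 1"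
        using le by linarith
      then show ?thesis
      proof cases
        case 1
        then have "e \<subseteq> L i"
          using vw i by (simp add: L_def)
        then show ?thesis
          using i(1) by (intro exI[of _ i]) simp
      next
        case 2
        then have "e \<subseteq> L i \<union> L (Suc i)"
          using vw i by (simp add: L_def)
        moreover have "Suc i < N"
          using 2 i(2) height[OF vw(3)] by linarith
        ultimately show ?thesis
          using i(1) by (intro exI[of _ i]) simp
      qed
    qed
  qed
  moreover have "\<exists>h. K = {v \<in> verts G. \<lfloor>y v\<rfloor> = h}" if "K \<in> set (map L [0..<N])" for K
    using that by (auto simp: L_def)
  ultimately show ?thesis
    using that by blast
qed

lemma layered_pathwidth_le:
  assumes "path_decomposition G Bs" and "layering G Ls"
    and "\<And>B L. B \<in> set Bs \<Longrightarrow> L \<in> set Ls \<Longrightarrow> card (B \<inter> L) \<le> k"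
  shows "layered_pathwidth G \<le> k"
  unfolding layered_pathwidth_def using assms by (intro Least_le) blast

lemma card_clique_le_clique_number:
  assumes "finite (verts G)" and "clique G C"
  shows "card C \<le> clique_number G"
proof -
  have "{C. clique G C} \<subseteq> Pow (verts G)"
    by (auto simp: clique_def)
  then have "finite {C. clique G C}"
    using assms(1) by (meson finite_Pow_iff finite_subset)
  then show ?thesis
    unfolding clique_number_def using assms(2) by (intro Max_ge) auto
qed

text \<open>The sum of the coordinate distances bounds the Euclidean distance, and two halves make 1.\<close>

lemma dist_le_1_if_coordinates_close:
  fixes v w :: "real ^ 2"
  assumes "\<bar>v $ 1 - w $ 1\<bar> \<le> 1 / 2" and "\<bar>v $ 2 - w $ 2\<bar> \<le> 1 / 2"
  shows "dist v w \<le> 1"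
proof -
  have "dist v w \<le> (\<Sum>i\<in>UNIV. \<bar>(v - w) $ i\<bar>)"
    unfolding dist_norm by (rule norm_le_l1_cart)
  also have "\<dots> \<le> 1"
    using assms by (simp add: sum_2)
  finally show ?thesis .
qed

lemma card_half_square_le:
  assumes "finite P" and "S \<subseteq> P"
    and "\<And>v. v \<in> S \<Longrightarrow> a \<le> v $ 1 \<and> v $ 1 \<le> a + 1 / 2 \<and> b \<le> v $ 2 \<and> v $ 2 \<le> b + 1 / 2"
  shows "card S \<le> clique_number (unit_disc_graph P)"
proof (rule card_clique_le_clique_number)
  have "dist v w \<le> 1" if "v \<in> S" "w \<in> S" for v w
    using assms(3)[OF that(1)] assms(3)[OF that(2)]
    by (intro dist_le_1_if_coordinates_close) linarith+
  then show "clique (unit_disc_graph P) S"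
    using assms(2) by (fastforce simp: clique_def unit_disc_graph_def)
qed (simp add: unit_disc_graph_def assms(1))

text \<open>The four closed quarters overlap, which is harmless for an upper bound.\<close>

lemma card_unit_square_le:
  assumes "finite P" and "S \<subseteq> P"
    and S: "\<And>v. v \<in> S \<Longrightarrow> a \<le> v $ 1 \<and> v $ 1 \<le> a + 1 \<and> b \<le> v $ 2 \<and> v $ 2 \<le> b + 1"
  shows "card S \<le> 4 * clique_number (unit_disc_graph P)"
proof -
  define Q where "Q a' b' = {v \<in> S. a' \<le> v $ 1 \<and> v $ 1 \<le> a' + 1 / 2 \<and>
    b' \<le> v $ 2 \<and> v $ 2 \<le> b' + 1 / 2}" for a' b'
  have Q: "card (Q a' b') \<le> clique_number (unit_disc_graph P)" for a' b'
    using assms(1,2) by (intro card_half_square_le[where a = a' and b = b']) (auto simp: Q_def)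
  have "finite S"
    using assms(1,2) by (rule rev_finite_subset)
  then have fin: "finite (Q a' b')" for a' b'
    by (simp add: Q_def)
  have "S \<subseteq> (Q a b \<union> Q (a + 1 / 2) b) \<union> (Q a (b + 1 / 2) \<union> Q (a + 1 / 2) (b + 1 / 2))"
    using S by (fastforce simp: Q_def)
  then have "card S \<le>
      card ((Q a b \<union> Q (a + 1 / 2) b) \<union> (Q a (b + 1 / 2) \<union> Q (a + 1 / 2) (b + 1 / 2)))"
    using fin by (intro card_mono) auto
  also have "\<dots> \<le> (card (Q a b) + card (Q (a + 1 / 2) b)) +
      (card (Q a (b + 1 / 2)) + card (Q (a + 1 / 2) (b + 1 / 2)))"
    by (intro order_trans[OF card_Un_le] add_mono card_Un_le)
  also have "\<dots> \<le> 4 * clique_number (unit_disc_graph P)"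
    using Q[of a b] Q[of "a + 1 / 2" b] Q[of a "b + 1 / 2"] Q[of "a + 1 / 2" "b + 1 / 2"]
    by linarith
  finally show ?thesis .
qed

theorem theorem20:
  fixes P :: "(real ^ 2) set" and k :: nat
  assumes "finite P"
    and "clique_number (unit_disc_graph P) = k"
  shows "layered_pathwidth (unit_disc_graph P) \<le> 4 * k"
proof -
  let ?G = "unit_disc_graph P"
  have verts: "verts ?G = P"
    by (simp add: unit_disc_graph_def)
  then have fin: "finite (verts ?G)"
    using assms(1) by simp
  have edge: "\<exists>v w. e = {v, w} \<and> v \<in> verts ?G \<and> w \<in> verts ?G \<and> \<bar>v $ i - w $ i\<bar> \<le> 1"
    if e: "e \<in> edges ?G" for e and i :: 2
  proof -
    obtain v w where vw: "e = {v, w}" "v \<in> P" "w \<in> P" "dist v w \<le> 1"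
      using e by (auto simp: unit_disc_graph_def)
    then have "\<bar>v $ i - w $ i\<bar> \<le> 1"
      using dist_vec_nth_le[of v i w] by (simp add: dist_real_def)
    then show ?thesis
      using vw verts by blast
  qed
  obtain Ls where Ls: "layering ?G Ls"
      and strip: "\<And>L. L \<in> set Ls \<Longrightarrow> \<exists>h. L = {v \<in> verts ?G. \<lfloor>v $ 2\<rfloor> = h}"
    using layering_floor[of ?G "\<lambda>v. v $ 2"] fin edge by blast
  show ?thesis
  proof (rule layered_pathwidth_le[OF path_decomposition_sliding_window[OF fin edge] Ls])
    fix B L
    assume "B \<in> set (map (\<lambda>t. {v \<in> verts ?G. t \<le> v $ 1 \<and> v $ 1 \<le> t + 1})
      (sorted_list_of_set ((\<lambda>v. v $ 1) ` verts ?G)))" and "L \<in> set Ls"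
    then have "\<exists>t. B = {v \<in> P. t \<le> v $ 1 \<and> v $ 1 \<le> t + 1}"
        and "\<exists>h. L = {v \<in> P. \<lfloor>v $ 2\<rfloor> = h}"
      using strip verts by auto
    then obtain t h where "B = {v \<in> P. t \<le> v $ 1 \<and> v $ 1 \<le> t + 1}"
        and "L = {v \<in> P. \<lfloor>v $ 2\<rfloor> = h}"
      by blast
    then have "card (B \<inter> L) \<le> 4 * clique_number ?G"
      using assms(1)
      by (intro card_unit_square_le[where a = t and b = "of_int h"]) (auto simp: floor_eq_iff)
    then show "card (B \<inter> L) \<le> 4 * k"
      using assms(2) by simp
  qed
qed

end
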